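(* A circular net $f:\mathbb Z^m\to\mathbb R^N$ with $m\ge3$ (in general position) is discrete isothermic if and only if for every $u\in\mathbb Z^m$ and every triple of distinct indices $i,j,k$, $$q(f,f_i,f_{ij},f_j)\cdot q(f,f_j,f_{jk},f_k)\cdot q(f,f_k,f_{ki},f_i)=1.$$
   Context: Notation: for $f:\mathbb Z^m\to\mathbb R^N$, $f=f(u)$, $f_i=f(u+e_i)$, $f_{ij}=f_{ji}=f(u+e_i+e_j)$ with $e_i$ the unit vectors. A Q-net is a map such that each elementary quadrilateral $(f,f_i,f_{ij},f_j)$ ($i\ne j$) is planar, assumed non-degenerate (distinct vertices, no three collinear, diagonals meeting in a point distinct from the vertices). Two planar quadrilaterals $(A,B,C,D)$, $(A^*,B^*,C^*,D^* )$ are dual if $A^*B^*\parallel AB$, $B^*C^*\parallel BC$, $C^*D^*\parallel CD$, $D^*A^*\parallel DA$, $A^*C^*\parallel BD$, $B^*D^*\parallel AC$. A Q-net $f$ is a discrete Koenigs net if there is a Q-net $f^*$ with every $(f^*,f^*_i,f^*_{ij},f^*_j)$ dual to $(f,f_i,f_{ij},f_j)$. A circular net is a Q-net all of whose elementary quadrilaterals have their four vertices on a circle. A discrete isothermic net is a circular net which is a discrete Koenigs net. For four concircular points $a,b,c,d\in\mathbb R^N$, their cross-ratio is $q(a,b,c,d)=(a-b)(b-c)^{-1}(c-d)(d-a)^{-1}$, computed after identifying a $2$-plane containing them with $\mathbb C$ (complex multiplication); it is real and independent of the identification. *)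

theory Defs
  imports "HOL-Analysis.Analysis"
begin

definition sh :: "int^'m \<Rightarrow> 'm \<Rightarrow> int^'m" where
  "sh u i = u + axis i 1"

definition nondeg_quad :: "real^'n \<Rightarrow> real^'n \<Rightarrow> real^'n \<Rightarrow> real^'n \<Rightarrow> bool" where
  "nondeg_quad A B C D \<longleftrightarrow>
     coplanar {A, B, C, D} \<and> distinct [A, B, C, D] \<and>
     \<not> collinear {A, B, C} \<and> \<not> collinear {A, B, D} \<and>
     \<not> collinear {A, C, D} \<and> \<not> collinear {B, C, D} \<and>
     (\<exists>P. P \<in> affine hull {A, C} \<and> P \<in> affine hull {B, D} \<and> P \<notin> {A, B, C, D})"

definition Q_net :: "(int^'m \<Rightarrow> real^'n) \<Rightarrow> bool" where
  "Q_net f \<longleftrightarrow> (\<forall>u i j. i \<noteq> j \<longrightarrow>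
     nondeg_quad (f u) (f (sh u i)) (f (sh (sh u i) j)) (f (sh u j)))"

definition par :: "real^'n \<Rightarrow> real^'n \<Rightarrow> bool" where
  "par v w \<longleftrightarrow> (\<exists>c::real. v = c *\<^sub>R w)"

definition dual_quad :: "real^'n \<Rightarrow> real^'n \<Rightarrow> real^'n \<Rightarrow> real^'n \<Rightarrow>
    real^'n \<Rightarrow> real^'n \<Rightarrow> real^'n \<Rightarrow> real^'n \<Rightarrow> bool" where
  "dual_quad A B C D A' B' C' D' \<longleftrightarrow>
     par (B' - A') (B - A) \<and> par (C' - B') (C - B) \<and>
     par (D' - C') (D - C) \<and> par (A' - D') (A - D) \<and>
     par (C' - A') (D - B) \<and> par (D' - B') (C - A)"

definition koenigs_net :: "(int^'m \<Rightarrow> real^'n) \<Rightarrow> bool" where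
  "koenigs_net f \<longleftrightarrow> Q_net f \<and> (\<exists>g :: int^'m \<Rightarrow> real^'n. Q_net g \<and>
     (\<forall>u i j. i \<noteq> j \<longrightarrow>
        dual_quad (f u) (f (sh u i)) (f (sh (sh u i) j)) (f (sh u j))
                  (g u) (g (sh u i)) (g (sh (sh u i) j)) (g (sh u j))))"

definition concircular :: "real^'n \<Rightarrow> real^'n \<Rightarrow> real^'n \<Rightarrow> real^'n \<Rightarrow> bool" where
  "concircular A B C D \<longleftrightarrow> coplanar {A, B, C, D} \<and>
     (\<exists>z r. z \<in> affine hull {A, B, C, D} \<and> r > 0 \<and>
        dist z A = r \<and> dist z B = r \<and> dist z C = r \<and> dist z D = r)"

definition circular_net :: "(int^'m \<Rightarrow> real^'n) \<Rightarrow> bool" where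
  "circular_net f \<longleftrightarrow> Q_net f \<and> (\<forall>u i j. i \<noteq> j \<longrightarrow>
     concircular (f u) (f (sh u i)) (f (sh (sh u i) j)) (f (sh u j)))"

definition isothermic_net :: "(int^'m \<Rightarrow> real^'n) \<Rightarrow> bool" where
  "isothermic_net f \<longleftrightarrow> circular_net f \<and> koenigs_net f"

text \<open>Identification of the 2-plane through p spanned by orthonormal e1, e2 with C.\<close>
definition chart :: "real^'n \<Rightarrow> real^'n \<Rightarrow> real^'n \<Rightarrow> real^'n \<Rightarrow> complex" where
  "chart p e1 e2 x = Complex ((x - p) \<bullet> e1) ((x - p) \<bullet> e2)"

definition cross_ratio :: "real^'n \<Rightarrow> real^'n \<Rightarrow> real^'n \<Rightarrow> real^'n \<Rightarrow> complex" where
  "cross_ratio a b c d = (SOME q. \<exists>p e1 e2.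
     norm e1 = 1 \<and> norm e2 = 1 \<and> e1 \<bullet> e2 = 0 \<and>
     {a, b, c, d} \<subseteq> affine hull {p, p + e1, p + e2} \<and>
     q = (chart p e1 e2 a - chart p e1 e2 b) * inverse (chart p e1 e2 b - chart p e1 e2 c) *
         (chart p e1 e2 c - chart p e1 e2 d) * inverse (chart p e1 e2 d - chart p e1 e2 a))"

definition general_position :: "(int^'m \<Rightarrow> real^'n) \<Rightarrow> bool" where
  "general_position f \<longleftrightarrow> (\<forall>u i j k. i \<noteq> j \<and> j \<noteq> k \<and> k \<noteq> i \<longrightarrow>
     \<not> coplanar {f u, f (sh u i), f (sh u j), f (sh u k)})"

end

theory Submission
  imports Defs
begin

text \<open>
  Write \<open>F\<^sub>i = f\<^sub>i - f\<close> and \<open>f\<^sub>i\<^sub>j - f = p\<^sub>i\<^sub>j F\<^sub>i + p\<^sub>j\<^sub>i F\<^sub>j\<close>. On a circular quadrilateral the cross-ratio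
  equals \<open>- (p\<^sub>i\<^sub>j / p\<^sub>j\<^sub>i) |F\<^sub>i|\<^sup>2 / |F\<^sub>j|\<^sup>2\<close>, so around a vertex the norms telescope and the product is 1
  iff \<open>p\<^sub>i\<^sub>j p\<^sub>j\<^sub>k p\<^sub>k\<^sub>i = - p\<^sub>j\<^sub>i p\<^sub>k\<^sub>j p\<^sub>i\<^sub>k\<close>, the Menelaus condition for the diagonal intersection points on
  the triangle \<open>f\<^sub>i f\<^sub>j f\<^sub>k\<close>. If \<open>g\<close> is dual to \<open>f\<close> with \<open>g\<^sub>i - g = a\<^sub>i F\<^sub>i\<close>, then parallelism of
  \<open>g\<^sub>j - g\<^sub>i\<close> and \<open>f\<^sub>i\<^sub>j - f\<close> says \<open>a\<^sub>i / a\<^sub>j = - p\<^sub>i\<^sub>j / p\<^sub>j\<^sub>i\<close>, which gives the condition. Conversely, the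
  condition makes these ratios consistent at each vertex, and duality prescribes the transport
  \<open>a\<^sub>j(u + e\<^sub>i) = a\<^sub>i(u) / (1 - p\<^sub>i\<^sub>j - p\<^sub>j\<^sub>i)\<close>. Comparing the coordinates of \<open>f\<^sub>i\<^sub>j\<^sub>k\<close> computed from the three
  faces through it (general position makes them unique) shows that this transport is well defined
  and flat, so it integrates over the lattice to \<open>a\<close>, and then the closed form \<open>a\<^sub>i F\<^sub>i\<close> integrates
  to \<open>g\<close>.
\<close>

section \<open>Sections of flat connections on the integer lattice\<close>

lemma sh_commute: "sh (sh u i) j = sh (sh u j) i"
  by (simp add: sh_def add_ac)

lemma int_iff_step_induct:
  fixes P :: "int \<Rightarrow> bool"
  assumes "P 0" and step: "\<And>n. P n \<longleftrightarrow> P (n + 1)"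
  shows "P n"
proof (induction n rule: int_induct[where k = 0])
  case (step2 i)
  then show ?case using step[of "i - 1"] by simp
qed (use assms in auto)

text \<open>Upwards the sequence iterates \<open>T\<close>, downwards it iterates the inverses,
  hence the bijectivity. The set \<open>X\<close> is a parameter because the lemma serves both
  scaling of nonzero reals and translation of a whole vector space.\<close>

lemma int_transport:
  fixes T :: "int \<Rightarrow> 'x \<Rightarrow> 'x"
  assumes bij: "\<And>n. bij_betw (T n) X X" and "x0 \<in> X"
  shows "\<exists>s. s 0 = x0 \<and> (\<forall>n. s n \<in> X \<and> s (n + 1) = T n (s n))"
proof -
  define sp where "sp = rec_nat x0 (\<lambda>k. T (int k))"
  \<comment> \<open>\<open>sm k\<close> is the value at \<open>- k\<close>; the next value inverts
    the step that leads from \<open>- k - 1\<close> to \<open>- k\<close>.\<close>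
  define sm where "sm = rec_nat x0 (\<lambda>k. inv_into X (T (- int k - 1)))"
  have sp: "sp 0 = x0" "sp (Suc k) = T (int k) (sp k)" for k by (simp_all add: sp_def)
  have sm: "sm 0 = x0" "sm (Suc k) = inv_into X (T (- int k - 1)) (sm k)" for k
    by (simp_all add: sm_def)
  have spX: "sp k \<in> X" for k
    by (induction k) (use \<open>x0 \<in> X\<close> bij bij_betwE in \<open>fastforce simp: sp\<close>)+
  have smX: "sm k \<in> X" for k
  proof (induction k)
    case (Suc k)
    then show ?case
      using bij_betwE[OF bij_betw_inv_into[OF bij]] by (simp add: sm)
  qed (simp add: sm \<open>x0 \<in> X\<close>)
  define s where "s n = (if n \<ge> 0 then sp (nat n) else sm (nat (- n)))" for n :: int
  have "s (n + 1) = T n (s n)" for n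
  proof (cases "n \<ge> 0")
    case True
    then show ?thesis by (simp add: s_def nat_add_distrib sp)
  next
    case False
    define k where "k = nat (- n - 1)"
    have k: "n = - int k - 1" using False by (simp add: k_def)
    have "T n (sm (Suc k)) = sm k"
      unfolding sm k using bij_betw_inv_into_right[OF bij smX] by simp
    moreover have "s n = sm (Suc k)"
      using False by (simp add: s_def k nat_add_distrib)
    moreover have "s (n + 1) = sm k" by (simp add: s_def k sp sm)
    ultimately show ?thesis by simp
  qed
  moreover have "s 0 = x0" "s n \<in> X" for n by (simp_all add: s_def sp spX smX)
  ultimately show ?thesis by blast
qed

text \<open>The section is built one coordinate direction at a time; flatness propagates the
  directions already treated along the new one.\<close>
lemma flat_connection_section:
  fixes T :: "int^'m \<Rightarrow> 'm \<Rightarrow> 'x \<Rightarrow> 'x"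
  assumes bij: "\<And>u i. bij_betw (T u i) X X" and "x0 \<in> X"
    and flat: "\<And>u i j x. i \<noteq> j \<Longrightarrow> x \<in> X \<Longrightarrow>
      T (sh u i) j (T u i x) = T (sh u j) i (T u j x)"
  shows "\<exists>s. \<forall>u. s u \<in> X \<and> (\<forall>i. s (sh u i) = T u i (s u))"
proof -
  \<comment> \<open>For a set \<open>S\<close> of treated directions, transport is demanded only on
    the sublattice where all other coordinates vanish; elsewhere the values are free. Thus a
    constant starts the induction, and \<open>S = UNIV\<close> leaves no restriction.\<close>
  have "\<exists>s. (\<forall>u. s u \<in> X) \<and>
      (\<forall>u i. (\<forall>l. l \<notin> S \<longrightarrow> u $ l = 0) \<longrightarrow> i \<in> S \<longrightarrow> s (sh u i) = T u i (s u))" for S :: "'m set"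
  proof (induction S rule: finite_induct[OF finite])
    case 1
    show ?case using \<open>x0 \<in> X\<close> by auto
  next
    case (2 k S)
    then obtain s where sX: "\<And>u. s u \<in> X" and
      s: "\<And>u i. (\<And>l. l \<notin> S \<Longrightarrow> u $ l = 0) \<Longrightarrow> i \<in> S \<Longrightarrow> s (sh u i) = T u i (s u)"
      by blast
    have "\<exists>t. t 0 = s v \<and> (\<forall>n. t n \<in> X \<and> t (n + 1) = T (v + axis k n) k (t n))" for v
      using int_transport[of "\<lambda>n. T (v + axis k n) k" X "s v"] bij sX by blast
    then obtain t where t0: "\<And>v. t v 0 = s v" and tX: "\<And>v n. t v n \<in> X"
      and t: "\<And>v n. t v (n + 1) = T (v + axis k n) k (t v n)"
      by metis
    \<comment> \<open>\<open>z\<close> projects along direction \<open>k\<close> to the hyperplane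
      where that coordinate is 0; the new section carries the old value at \<open>z u\<close> along
      the line to \<open>u\<close>.\<close>
    define z where "z u = u - axis k (u $ k)" for u :: "int^'m"
    have z: "z u + axis k (u $ k) = u" for u by (simp add: z_def)
    define s' where "s' u = t (z u) (u $ k)" for u
    have "s' (sh u i) = T u i (s' u)"
      if supp: "\<And>l. l \<notin> insert k S \<Longrightarrow> u $ l = 0" and i: "i \<in> insert k S" for u i
    proof (cases "i = k")
      case True
      have "z (sh u k) = z u" by (simp add: z_def sh_def vec_eq_iff axis_def)
      moreover have "sh u k $ k = u $ k + 1" by (simp add: sh_def)
      ultimately show ?thesis using t[of "z u" "u $ k"] True by (simp add: s'_def z)
    next
      case False
      then have "i \<in> S" using i by simp
      have shz: "z (sh u i) = sh (z u) i" and shk: "sh u i $ k = u $ k"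
        using False by (auto simp: z_def sh_def vec_eq_iff axis_def)
      \<comment> \<open>At \<open>w\<close>, flatness turns the \<open>i\<close>-relation at height
        \<open>n\<close> into the one at height \<open>n + 1\<close> after applying
        \<open>T (sh w i) k\<close>. This map is injective, so the two are equivalent and the
        induction also runs downwards.\<close>
      have "t (sh (z u) i) n = T (z u + axis k n) i (t (z u) n)" for n
      proof (induction n rule: int_iff_step_induct)
        case 1
        have "s (sh (z u) i) = T (z u) i (s (z u))"
          by (rule s[OF _ \<open>i \<in> S\<close>]) (use supp in \<open>auto simp: z_def axis_def\<close>)
        moreover have "z u + axis k 0 = z u" by (simp add: vec_eq_iff axis_def)
        ultimately show ?case by (simp only: t0)
      next
        case (2 n)
        define w where "w = z u + axis k n"
        have w: "sh (z u) i + axis k n = sh w i" "z u + axis k (n + 1) = sh w k"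
          by (auto simp: w_def sh_def vec_eq_iff axis_def)
        have inT: "T w i (t (z u) n) \<in> X" using bij_betwE[OF bij] tX by blast
        have "t (sh (z u) i) (n + 1) = T (sh w i) k (t (sh (z u) i) n)"
          using t[of "sh (z u) i" n] w by simp
        moreover have "T (sh w k) i (t (z u) (n + 1)) = T (sh w i) k (T w i (t (z u) n))"
          using t[of "z u" n] flat[OF False tX] by (simp add: w_def)
        ultimately show ?case
          using inj_on_eq_iff[OF bij_betw_imp_inj_on[OF bij] tX inT] unfolding w w_def[symmetric]
          by metis
      qed
      then show ?thesis by (simp add: s'_def shz shk z)
    qed
    moreover have "s' u \<in> X" for u by (simp add: s'_def tX)
    ultimately show ?case by blast
  qed
  from this[of UNIV] show ?thesis by auto
qed

section \<open>Planar quadrilaterals in affine coordinates\<close>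

lemma not_collinear_coeffs_unique:
  fixes X Y :: "real^'n"
  assumes "\<not> collinear {0, X, Y}" and "a *\<^sub>R X + b *\<^sub>R Y = a' *\<^sub>R X + b' *\<^sub>R Y"
  shows "a = a'" "b = b'"
proof -
  have X: "X \<noteq> 0" and Y: "\<nexists>c. Y = c *\<^sub>R X" using assms(1) by (auto simp: collinear_lemma)
  have e: "(b - b') *\<^sub>R Y = (a' - a) *\<^sub>R X"
    using assms(2) by (simp add: algebra_simps)
  show "b = b'"
  proof (rule ccontr)
    assume "b \<noteq> b'"
    then have "Y = ((a' - a) / (b - b')) *\<^sub>R X"
      using arg_cong[OF e, of "\<lambda>x. (1 / (b - b')) *\<^sub>R x"] by simp
    then show False using Y by blast
  qed
  then show "a = a'" using e X by simp
qed

lemma not_coplanar_independent: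
  fixes A :: "real^'n"
  assumes "\<not> coplanar {A, B, C, D}"
    and "a *\<^sub>R (B - A) + b *\<^sub>R (C - A) + c *\<^sub>R (D - A) = 0"
  shows "a = 0 \<and> b = 0 \<and> c = 0"
proof -
  \<comment> \<open>A nonzero coefficient lets its vector be solved for in terms of the other two;
    permuting the vectors treats the other coefficients.\<close>
  have *: "coplanar {A, A + X, A + Y, A + Z}"
    if "a *\<^sub>R X + b *\<^sub>R Y + c *\<^sub>R Z = 0" and "a \<noteq> 0" for X Y Z :: "real^'n" and a b c
  proof -
    have "a *\<^sub>R X = - b *\<^sub>R Y - c *\<^sub>R Z" using that(1) by (simp add: algebra_simps eq_neg_iff_add_eq_0)
    then have "(1 / a) *\<^sub>R (a *\<^sub>R X) = (1 / a) *\<^sub>R (- b *\<^sub>R Y - c *\<^sub>R Z)" by simp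
    then have X: "X = (- b / a) *\<^sub>R Y + (- c / a) *\<^sub>R Z"
      using \<open>a \<noteq> 0\<close> by (simp add: scaleR_right_diff_distrib)
    have "A + X = (1 + b / a + c / a) *\<^sub>R A + (- b / a) *\<^sub>R (A + Y) + (- c / a) *\<^sub>R (A + Z)"
      by (subst X) (simp add: algebra_simps)
    moreover have "(1 + b / a + c / a) + (- b / a) + (- c / a) = 1" by simp
    ultimately have "A + X \<in> affine hull {A, A + Y, A + Z}"
      unfolding affine_hull_3 by blast
    then have "{A, A + X, A + Y, A + Z} \<subseteq> affine hull {A, A + Y, A + Z}"
      by (auto intro: hull_inc)
    then show ?thesis unfolding coplanar_def by blast
  qed
  show ?thesis
    using *[of a "B - A" b "C - A" c "D - A"] *[of b "C - A" a "B - A" c "D - A"]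
      *[of c "D - A" a "B - A" b "C - A"] assms
    by (auto simp: insert_commute add_ac)
qed

lemma collinear_translate_3:
  fixes A B C :: "real^'n"
  shows "collinear {A, B, C} \<longleftrightarrow> collinear {0, B - A, C - A}"
proof -
  have "collinear {A, B, C} \<longleftrightarrow> collinear {B, A, C}" by (simp add: insert_commute)
  also have "\<dots> \<longleftrightarrow> collinear {0, B - A, C - A}" by (rule collinear_3) (simp add: NO_MATCH_def)
  finally show ?thesis .
qed

text \<open>The 2 by 2 determinant criterion: all later collinearity tests become identities between
  coordinates.\<close>

lemma collinear_lincomb_iff:
  fixes X Y :: "real^'n"
  assumes "\<not> collinear {0, X, Y}"
  shows "collinear {0, a *\<^sub>R X + b *\<^sub>R Y, c *\<^sub>R X + d *\<^sub>R Y} \<longleftrightarrow> a * d = b * c"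
proof -
  note u = not_collinear_coeffs_unique[OF assms]
  have z: "a *\<^sub>R X + b *\<^sub>R Y = 0 \<longleftrightarrow> a = 0 \<and> b = 0" for a b
    using u[of a b 0 0] by auto
  have e: "(c *\<^sub>R X + d *\<^sub>R Y = t *\<^sub>R (a *\<^sub>R X + b *\<^sub>R Y)) \<longleftrightarrow> c = t * a \<and> d = t * b" for t
    using u[of c d "t * a" "t * b"] by (auto simp: algebra_simps)
  show ?thesis
    unfolding collinear_lemma z e
  proof (intro iffI)
    assume ad: "a * d = b * c"
    show "(a = 0 \<and> b = 0) \<or> (c = 0 \<and> d = 0) \<or> (\<exists>t. c = t * a \<and> d = t * b)"
    proof (cases "a = 0")
      case True
      show ?thesis
      proof (cases "b = 0")
        case False
        then have "c = (d / b) * a \<and> d = (d / b) * b" using True ad by simp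
        then show ?thesis by blast
      qed (use True in simp)
    next
      case False
      then have "c = (c / a) * a \<and> d = (c / a) * b" using ad by (simp add: field_simps)
      then show ?thesis by blast
    qed
  qed auto
qed

text \<open>Each inequality excludes one degeneracy: \<open>p = 0\<close> puts
  \<open>A, C, D\<close> on a line, \<open>r = 0\<close> puts \<open>A, B, C\<close>,
  \<open>p + r = 1\<close> puts \<open>B, C, D\<close>, and \<open>p + r = 0\<close> makes the
  diagonals parallel.\<close>

lemma nondeg_quad_imp_coords:
  fixes A B C D :: "real^'n"
  assumes "nondeg_quad A B C D"
  obtains p r where "\<not> collinear {0, B - A, D - A}"
    "C - A = p *\<^sub>R (B - A) + r *\<^sub>R (D - A)" "p \<noteq> 0" "r \<noteq> 0" "p + r \<noteq> 1" "p + r \<noteq> 0"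
proof -
  note nd = assms[unfolded nondeg_quad_def]
  define X Y where "X = B - A" and "Y = D - A"
  have nc: "\<not> collinear {0, X, Y}" using nd by (simp add: X_def Y_def collinear_translate_3[of A B D])
  note u = not_collinear_coeffs_unique[OF nc]
  \<comment> \<open>The coordinates of \<open>C\<close> come from the diagonal point:
    \<open>P - A\<close> is \<open>s\<close> times \<open>C - A\<close>, and as a point of the line
    \<open>BD\<close> it has coordinates with sum 1. Hence \<open>s * (p + r) = 1\<close>.\<close>
  obtain P where "P \<in> affine hull {A, C}" "P \<in> affine hull {B, D}" and PA: "P \<notin> {A, B, C, D}"
    using nd by blast
  then obtain s s' t t' where P1: "P = s' *\<^sub>R A + s *\<^sub>R C" "s' + s = 1"
    and P2: "P = t' *\<^sub>R B + t *\<^sub>R D" "t' + t = 1"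
    unfolding affine_hull_2 by blast
  have P1': "P - A = s *\<^sub>R (C - A)"
    using P1 by (simp add: algebra_simps) (metis scaleR_left_distrib scaleR_one)
  have P2': "P - A = t' *\<^sub>R X + t *\<^sub>R Y"
  proof -
    have "t' *\<^sub>R X + t *\<^sub>R Y = t' *\<^sub>R B + t *\<^sub>R D - (t' + t) *\<^sub>R A"
      by (simp add: X_def Y_def algebra_simps)
    then show ?thesis using P2 by simp
  qed
  have s0: "s \<noteq> 0" using P1' PA by auto
  have C: "C - A = (t' / s) *\<^sub>R X + (t / s) *\<^sub>R Y"
    using arg_cong[OF trans[OF P1'[symmetric] P2'], of "\<lambda>x. (1 / s) *\<^sub>R x"] s0
    by (simp add: scaleR_right_distrib)
  define p r where "p = t' / s" and "r = t / s"
  have C: "C - A = p *\<^sub>R X + r *\<^sub>R Y" using C by (simp add: p_def r_def)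
  have "p + r \<noteq> 0" using P2(2) s0 by (simp add: p_def r_def add_divide_distrib[symmetric])
  moreover have "r \<noteq> 0"
  proof
    assume "r = 0"
    then have "C - A = p *\<^sub>R X" using C by simp
    then have "collinear {A, B, C}"
      by (auto simp: collinear_translate_3[of A B C] collinear_lemma X_def)
    then show False using nd by blast
  qed
  moreover have "p \<noteq> 0"
  proof
    assume "p = 0"
    then have "C - A = r *\<^sub>R Y" using C by simp
    then have "collinear {A, D, C}"
      by (auto simp: collinear_translate_3[of A D C] collinear_lemma Y_def)
    then show False using nd by (simp add: insert_commute)
  qed
  moreover have "p + r \<noteq> 1"
  proof
    assume pr: "p + r = 1"
    have "B - D = 1 *\<^sub>R X + (-1) *\<^sub>R Y" by (simp add: X_def Y_def)
    moreover have "C - D = p *\<^sub>R X + (r - 1) *\<^sub>R Y"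
      using C by (simp add: Y_def algebra_simps)
    ultimately have "collinear {D, B, C}"
      unfolding collinear_translate_3[of D B C] using pr
      by (simp only: collinear_lincomb_iff[OF nc]) simp
    then show False using nd by (simp add: insert_commute)
  qed
  ultimately show ?thesis using that nc C unfolding X_def Y_def by blast
qed

lemma nondeg_quadI_coords:
  fixes A B C D :: "real^'n"
  assumes nc: "\<not> collinear {0, B - A, D - A}"
    and C: "C - A = p *\<^sub>R (B - A) + r *\<^sub>R (D - A)"
    and p: "p \<noteq> 0" and r: "r \<noteq> 0" and pr1: "p + r \<noteq> 1" and pr0: "p + r \<noteq> 0"
  shows "nondeg_quad A B C D"
proof -
  define X Y where "X = B - A" and "Y = D - A"
  have B': "B - A = 1 *\<^sub>R X + 0 *\<^sub>R Y" and D': "D - A = 0 *\<^sub>R X + 1 *\<^sub>R Y"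
    and C': "C - A = p *\<^sub>R X + r *\<^sub>R Y" and BD': "D - B = (-1) *\<^sub>R X + 1 *\<^sub>R Y"
    and BC': "C - B = (p - 1) *\<^sub>R X + r *\<^sub>R Y"
    using C by (simp_all add: X_def Y_def algebra_simps)
  have nc': "\<not> collinear {0, X, Y}" using nc by (simp add: X_def Y_def)
  note col = collinear_lincomb_iff[OF nc']
  have 1: "\<not> collinear {A, B, C}"
    unfolding collinear_translate_3[of A B C] unfolding B' C' col using r by simp
  have 2: "\<not> collinear {A, B, D}"
    unfolding collinear_translate_3[of A B D] using nc .
  have 3: "\<not> collinear {A, C, D}"
    unfolding collinear_translate_3[of A C D] unfolding C' D' col using p by simp
  have 4: "\<not> collinear {B, C, D}"
    unfolding collinear_translate_3[of B C D] unfolding BC' BD' col using pr1 by simp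
  have "distinct [A, B, C, D]"
    using 1 2 3 4 by (auto simp: insert_commute)
  moreover have "coplanar {A, B, C, D}"
  proof -
    have "C = (1 - p - r) *\<^sub>R A + p *\<^sub>R B + r *\<^sub>R D"
      using C by (simp add: algebra_simps)
    then have "C \<in> affine hull {A, B, D}" unfolding affine_hull_3 by force
    then have "{A, B, C, D} \<subseteq> affine hull {A, B, D}" by (auto intro: hull_inc)
    then show ?thesis unfolding coplanar_def by blast
  qed
  moreover have "\<exists>P. P \<in> affine hull {A, C} \<and> P \<in> affine hull {B, D} \<and> P \<notin> {A, B, C, D}"
  proof -
    \<comment> \<open>Scaling \<open>C - A\<close> by \<open>1 / (p + r)\<close> makes its
      coordinates sum to 1, which is where the diagonal reaches the line \<open>BD\<close>.\<close>
    define s P where "s = 1 / (p + r)" and "P = A + s *\<^sub>R (C - A)"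
    have s: "s * p + s * r = 1" "s \<noteq> 0" "s \<noteq> 1" using pr0 pr1
      by (auto simp: s_def add_divide_distrib[symmetric])
    have "P = (1 - s) *\<^sub>R A + s *\<^sub>R C" by (simp add: P_def algebra_simps)
    then have P1: "P \<in> affine hull {A, C}" unfolding affine_hull_2 by force
    have "P = A + (s * p) *\<^sub>R (B - A) + (s * r) *\<^sub>R (D - A)"
      by (simp add: P_def C algebra_simps)
    also have "\<dots> = (1 - (s * p + s * r)) *\<^sub>R A + (s * p) *\<^sub>R B + (s * r) *\<^sub>R D"
      by (simp add: algebra_simps)
    finally have "P = (s * p) *\<^sub>R B + (s * r) *\<^sub>R D" using s by simp
    then have P2: "P \<in> affine hull {B, D}" unfolding affine_hull_2 using s by blast
    have PA: "P - A = (s * p) *\<^sub>R X + (s * r) *\<^sub>R Y"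
      by (simp add: P_def C X_def Y_def algebra_simps)
    have "P - A \<noteq> a *\<^sub>R X + b *\<^sub>R Y" if "a \<noteq> s * p \<or> b \<noteq> s * r" for a b
      unfolding PA using not_collinear_coeffs_unique[OF nc', of "s * p" "s * r" a b] that by metis
    from this[of 0 0] this[of 1 0] this[of p r] this[of 0 1]
    have "P - A \<noteq> 0 *\<^sub>R X + 0 *\<^sub>R Y" "P - A \<noteq> B - A" "P - A \<noteq> C - A" "P - A \<noteq> D - A"
      unfolding B' C' D' using s p r by auto
    then have "P \<notin> {A, B, C, D}" by auto
    then show ?thesis using P1 P2 by blast
  qed
  ultimately show ?thesis using 1 2 3 4 by (simp add: nondeg_quad_def)
qed

section \<open>Circles and cross-ratios in affine coordinates\<close>

text \<open>Equal distance of \<open>A\<close> and \<open>Q\<close> from the centre means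
  \<open>2 * ((z - A) \<bullet> (Q - A)) = (norm (Q - A))\<^sup>2\<close>. The left side is linear
  in \<open>Q - A\<close>, so the equations for \<open>B\<close> and \<open>D\<close> eliminate the
  centre from the one for \<open>C\<close>.\<close>

lemma concircular_coords:
  fixes A B C D :: "real^'n"
  assumes "concircular A B C D" and C: "C - A = p *\<^sub>R (B - A) + r *\<^sub>R (D - A)"
  shows "p * (1 - p) * (norm (B - A))\<^sup>2 + r * (1 - r) * (norm (D - A))\<^sup>2
    = 2 * p * r * ((B - A) \<bullet> (D - A))"
proof -
  obtain z where z: "dist z A = dist z B" "dist z A = dist z C" "dist z A = dist z D"
    using assms(1) unfolding concircular_def by metis
  have *: "2 * ((z - A) \<bullet> (Q - A)) = (norm (Q - A))\<^sup>2" if "dist z A = dist z Q" for Q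
  proof -
    have "(norm ((z - A) - (Q - A)))\<^sup>2 = (norm (z - A))\<^sup>2" using that by (simp add: dist_norm)
    then show ?thesis by (simp add: power2_norm_eq_inner inner_diff_left inner_diff_right inner_commute)
  qed
  define X Y Z where "X = B - A" and "Y = D - A" and "Z = z - A"
  have X: "2 * (Z \<bullet> X) = X \<bullet> X" and Y: "2 * (Z \<bullet> Y) = Y \<bullet> Y"
    and "2 * (Z \<bullet> (p *\<^sub>R X + r *\<^sub>R Y)) = (p *\<^sub>R X + r *\<^sub>R Y) \<bullet> (p *\<^sub>R X + r *\<^sub>R Y)"
    using *[OF z(1)] *[OF z(2)] *[OF z(3)] C
    by (simp_all add: X_def Y_def Z_def power2_norm_eq_inner)
  then have "p * (2 * (Z \<bullet> X)) + r * (2 * (Z \<bullet> Y))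
      = p * p * (X \<bullet> X) + 2 * p * r * (X \<bullet> Y) + r * r * (Y \<bullet> Y)"
    by (simp add: inner_add_left inner_add_right inner_commute algebra_simps)
  then show ?thesis unfolding X Y
    by (simp add: X_def[symmetric] Y_def[symmetric] power2_norm_eq_inner algebra_simps)
qed

text \<open>Gram-Schmidt on \<open>X\<close> and \<open>Y\<close>; it provides a chart of their
  plane.\<close>

lemma orthonormal_chart_exists:
  fixes X Y :: "real^'n"
  assumes "\<not> collinear {0, X, Y}"
  obtains e1 e2 where "norm e1 = 1" "norm e2 = 1" "e1 \<bullet> e2 = 0"
    "X = (X \<bullet> e1) *\<^sub>R e1 + (X \<bullet> e2) *\<^sub>R e2" "Y = (Y \<bullet> e1) *\<^sub>R e1 + (Y \<bullet> e2) *\<^sub>R e2"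
proof -
  have X: "X \<noteq> 0" and Y: "\<nexists>c. Y = c *\<^sub>R X" using assms by (auto simp: collinear_lemma)
  define e1 where "e1 = sgn X"
  have e1: "norm e1 = 1" using X by (simp add: e1_def norm_sgn)
  then have e11: "e1 \<bullet> e1 = 1" by (simp add: norm_eq_1)
  have Xe: "X = norm X *\<^sub>R e1" using X by (simp add: e1_def sgn_div_norm)
  define W where "W = Y - (Y \<bullet> e1) *\<^sub>R e1"
  have W0: "W \<noteq> 0"
  proof
    assume "W = 0"
    then have "Y = (Y \<bullet> e1) *\<^sub>R e1" by (simp add: W_def)
    also have "\<dots> = ((Y \<bullet> e1) / norm X) *\<^sub>R X" using X by (simp add: e1_def sgn_div_norm divide_inverse)
    finally show False using Y by blast
  qed
  have We: "W \<bullet> e1 = 0" by (simp add: W_def inner_diff_left e11)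
  define e2 where "e2 = sgn W"
  have e2: "norm e2 = 1" using W0 by (simp add: e2_def norm_sgn)
  then have e22: "e2 \<bullet> e2 = 1" by (simp add: norm_eq_1)
  have We2: "W = norm W *\<^sub>R e2" using W0 by (simp add: e2_def sgn_div_norm)
  have e12: "e1 \<bullet> e2 = 0" using We by (simp add: e2_def sgn_div_norm inner_commute)
  have X': "X \<bullet> e1 = norm X" "X \<bullet> e2 = 0"
    by (subst Xe, simp add: e11 e12)+
  have Ye: "Y = (Y \<bullet> e1) *\<^sub>R e1 + norm W *\<^sub>R e2" using We2 by (simp add: W_def)
  have "Y \<bullet> e2 = norm W" by (subst Ye) (simp add: inner_add_left e12 e22)
  then show ?thesis using that[OF e1 e2 e12] X' Xe Ye by simp
qed

text \<open>Since \<open>cross_ratio\<close> is defined by choice, two things are shown: every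
  admissible chart yields the stated value, and an admissible chart exists.\<close>

lemma cross_ratio_coords:
  fixes A B C D :: "real^'n"
  assumes nc: "\<not> collinear {0, B - A, D - A}"
    and C: "C - A = p *\<^sub>R (B - A) + r *\<^sub>R (D - A)"
    and p: "p \<noteq> 0" and r: "r \<noteq> 0" and "concircular A B C D"
  shows "cross_ratio A B C D
    = of_real (- (p / r) * ((norm (B - A))\<^sup>2 / (norm (D - A))\<^sup>2))" (is "_ = ?q")
proof -
  define X Y where "X = B - A" and "Y = D - A"
  note nc = nc[folded X_def Y_def] and C = C[folded X_def Y_def]
  have circ: "p * (1 - p) * (X \<bullet> X) + r * (1 - r) * (Y \<bullet> Y) = 2 * p * r * (X \<bullet> Y)"
    using concircular_coords[OF assms(5) assms(2)] by (simp add: X_def Y_def power2_norm_eq_inner)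
  let ?is_cr = "\<lambda>q. \<exists>c0 e1 e2.
     norm e1 = 1 \<and> norm e2 = 1 \<and> e1 \<bullet> e2 = 0 \<and>
     {A, B, C, D} \<subseteq> affine hull {c0, c0 + e1, c0 + e2} \<and>
     q = (chart c0 e1 e2 A - chart c0 e1 e2 B) * inverse (chart c0 e1 e2 B - chart c0 e1 e2 C) *
         (chart c0 e1 e2 C - chart c0 e1 e2 D) * inverse (chart c0 e1 e2 D - chart c0 e1 e2 A)"
  have unique: "q = ?q" if "?is_cr q" for q
  proof -
    from that obtain c0 e1 e2 where e: "norm e1 = 1" "norm e2 = 1" and e12: "e1 \<bullet> e2 = 0"
      and sub: "{A, B, C, D} \<subseteq> affine hull {c0, c0 + e1, c0 + e2}"
      and q: "q = (chart c0 e1 e2 A - chart c0 e1 e2 B) * inverse (chart c0 e1 e2 B - chart c0 e1 e2 C) *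
         (chart c0 e1 e2 C - chart c0 e1 e2 D) * inverse (chart c0 e1 e2 D - chart c0 e1 e2 A)"
      by blast
    have ee: "e1 \<bullet> e1 = 1" "e2 \<bullet> e2 = 1" "e2 \<bullet> e1 = 0"
      using e e12 by (simp_all add: norm_eq_1 inner_commute)
    have pl: "\<exists>a b. Q = c0 + a *\<^sub>R e1 + b *\<^sub>R e2" if "Q \<in> {A, B, C, D}" for Q
    proof -
      have "Q \<in> affine hull {c0, c0 + e1, c0 + e2}" using that sub by blast
      then obtain u v w where Q: "Q = u *\<^sub>R c0 + v *\<^sub>R (c0 + e1) + w *\<^sub>R (c0 + e2)"
        and uvw: "u + v + w = 1"
        unfolding affine_hull_3 by auto
      have "Q = (u + v + w) *\<^sub>R c0 + v *\<^sub>R e1 + w *\<^sub>R e2"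
        unfolding Q by (simp add: algebra_simps)
      then have "Q = c0 + v *\<^sub>R e1 + w *\<^sub>R e2" unfolding uvw by simp
      then show ?thesis by auto
    qed
    obtain a1 a2 b1 b2 d1 d2 where "A = c0 + a1 *\<^sub>R e1 + a2 *\<^sub>R e2"
      "B = c0 + b1 *\<^sub>R e1 + b2 *\<^sub>R e2" "D = c0 + d1 *\<^sub>R e1 + d2 *\<^sub>R e2"
      using pl[of A] pl[of B] pl[of D] by blast
    then have "X = (b1 - a1) *\<^sub>R e1 + (b2 - a2) *\<^sub>R e2" "Y = (d1 - a1) *\<^sub>R e1 + (d2 - a2) *\<^sub>R e2"
      by (simp_all add: X_def Y_def algebra_simps)
    then obtain x1 x2 y1 y2 where X: "X = x1 *\<^sub>R e1 + x2 *\<^sub>R e2" and Y: "Y = y1 *\<^sub>R e1 + y2 *\<^sub>R e2"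
      by blast
    define \<zeta> \<omega> where "\<zeta> = Complex x1 x2" and "\<omega> = Complex y1 y2"
    have ch: "chart c0 e1 e2 Q - chart c0 e1 e2 R = Complex ((Q - R) \<bullet> e1) ((Q - R) \<bullet> e2)" for Q R
      by (simp add: chart_def complex_eq_iff inner_diff_left)
    have BC: "B - C = (1 - p) *\<^sub>R X - r *\<^sub>R Y" and CD: "C - D = p *\<^sub>R X + (r - 1) *\<^sub>R Y"
      and AB: "A - B = - X"
      using C by (simp_all add: X_def Y_def algebra_simps)
    have c1: "chart c0 e1 e2 A - chart c0 e1 e2 B = - \<zeta>"
      unfolding ch AB by (simp add: X \<zeta>_def inner_diff_left ee e12 complex_eq_iff)
    have c2: "chart c0 e1 e2 D - chart c0 e1 e2 A = \<omega>"
      unfolding ch Y_def[symmetric] by (simp add: Y \<omega>_def inner_add_left ee e12 complex_eq_iff)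
    have c3: "chart c0 e1 e2 B - chart c0 e1 e2 C = of_real (1 - p) * \<zeta> - of_real r * \<omega>"
      unfolding ch BC
      by (simp add: X Y \<zeta>_def \<omega>_def inner_add_left inner_diff_left ee e12 complex_eq_iff)
    have c4: "chart c0 e1 e2 C - chart c0 e1 e2 D = of_real p * \<zeta> + of_real (r - 1) * \<omega>"
      unfolding ch CD
      by (simp add: X Y \<zeta>_def \<omega>_def inner_add_left inner_diff_left ee e12 complex_eq_iff)
    have XX: "X \<bullet> X = x1\<^sup>2 + x2\<^sup>2" and YY: "Y \<bullet> Y = y1\<^sup>2 + y2\<^sup>2" and XY: "X \<bullet> Y = x1 * y1 + x2 * y2"
      by (simp_all add: X Y inner_add_left inner_add_right ee e12 power2_eq_square algebra_simps)
    have Y0: "\<omega> \<noteq> 0" using nc Y by (auto simp: \<omega>_def complex_eq_iff insert_commute)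
    have N0: "of_real (1 - p) * \<zeta> - of_real r * \<omega> \<noteq> 0"
    proof
      assume "of_real (1 - p) * \<zeta> - of_real r * \<omega> = 0"
      then have "(1 - p) * x1 = r * y1" "(1 - p) * x2 = r * y2"
        by (simp_all add: \<zeta>_def \<omega>_def complex_eq_iff)
      then have "(1 - p) *\<^sub>R X + (- r) *\<^sub>R Y = 0 *\<^sub>R X + 0 *\<^sub>R Y"
        by (simp add: X Y scaleR_right_distrib)
      from not_collinear_coeffs_unique(2)[OF nc this] r show False by simp
    qed
    have nX: "of_real ((norm X)\<^sup>2) = \<zeta> * cnj \<zeta>" and nY: "of_real ((norm Y)\<^sup>2) = \<omega> * cnj \<omega>"
      by (simp_all add: power2_norm_eq_inner XX YY \<zeta>_def \<omega>_def complex_mult_cnj)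
    have nY0: "of_real ((norm Y)\<^sup>2) \<noteq> (0 :: complex)" unfolding nY using Y0 by simp
    \<comment> \<open>This is the circle equation \<open>circ\<close> in complex form, because
      \<zeta> times the conjugate of \<omega> plus its conjugate is
      \<open>2 * (X \<bullet> Y)\<close>. It relates the numerator and denominator factors of the
      cross-ratio that involve \<open>C\<close>.\<close>
    have key: "(of_real p * \<zeta> + of_real (r - 1) * \<omega>) * of_real r * cnj \<omega>
      = of_real p * cnj \<zeta> * (of_real (1 - p) * \<zeta> - of_real r * \<omega>)"
      using circ unfolding XX YY XY
      by (simp add: \<zeta>_def \<omega>_def complex_eq_iff power2_eq_square algebra_simps)
    have "q = - \<zeta> * (of_real p * \<zeta> + of_real (r - 1) * \<omega>)
        / ((of_real (1 - p) * \<zeta> - of_real r * \<omega>) * \<omega>)"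
      unfolding q c1 c2 c3 c4 by (simp only: divide_inverse inverse_mult_distrib mult_ac)
    also have "\<dots> = - of_real p * of_real ((norm X)\<^sup>2) / (of_real r * of_real ((norm Y)\<^sup>2))"
    proof (subst frac_eq_eq)
      show "- \<zeta> * (of_real p * \<zeta> + of_real (r - 1) * \<omega>) * (of_real r * of_real ((norm Y)\<^sup>2))
        = - of_real p * of_real ((norm X)\<^sup>2) * ((of_real (1 - p) * \<zeta> - of_real r * \<omega>) * \<omega>)"
        unfolding nX nY using arg_cong[OF key, of "\<lambda>x. \<zeta> * \<omega> * x"]
        by (simp only: mult_minus_left mult_minus_right mult_ac)
    qed (use N0 Y0 nY0 r in auto)
    finally show ?thesis by (simp add: X_def Y_def)
  qed
  obtain e1 e2 where e: "norm e1 = 1" "norm e2 = 1" "e1 \<bullet> e2 = 0"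
    and X: "X = (X \<bullet> e1) *\<^sub>R e1 + (X \<bullet> e2) *\<^sub>R e2" and Y: "Y = (Y \<bullet> e1) *\<^sub>R e1 + (Y \<bullet> e2) *\<^sub>R e2"
    using orthonormal_chart_exists[OF nc] by blast
  have hull: "A + x *\<^sub>R e1 + y *\<^sub>R e2 \<in> affine hull {A, A + e1, A + e2}" for x y
  proof -
    have "A + x *\<^sub>R e1 + y *\<^sub>R e2 = (1 - x - y) *\<^sub>R A + x *\<^sub>R (A + e1) + y *\<^sub>R (A + e2)"
      by (simp add: algebra_simps)
    then show ?thesis unfolding affine_hull_3 by force
  qed
  have "B = A + (X \<bullet> e1) *\<^sub>R e1 + (X \<bullet> e2) *\<^sub>R e2" "D = A + (Y \<bullet> e1) *\<^sub>R e1 + (Y \<bullet> e2) *\<^sub>R e2"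
    using X Y by (simp_all add: X_def Y_def add.assoc algebra_simps)
  moreover have "C = A + (p * (X \<bullet> e1) + r * (Y \<bullet> e1)) *\<^sub>R e1 + (p * (X \<bullet> e2) + r * (Y \<bullet> e2)) *\<^sub>R e2"
  proof -
    have "C = A + (p *\<^sub>R X + r *\<^sub>R Y)" using C by (simp add: algebra_simps)
    also have "p *\<^sub>R X + r *\<^sub>R Y = p *\<^sub>R ((X \<bullet> e1) *\<^sub>R e1 + (X \<bullet> e2) *\<^sub>R e2)
        + r *\<^sub>R ((Y \<bullet> e1) *\<^sub>R e1 + (Y \<bullet> e2) *\<^sub>R e2)" using X Y by simp
    finally show ?thesis by (simp add: algebra_simps)
  qed
  ultimately have "{A, B, C, D} \<subseteq> affine hull {A, A + e1, A + e2}"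
    using hull by (metis empty_subsetI hull_inc insertI1 insert_subset)
  then have "\<exists>q. ?is_cr q" using e by blast
  then have "?is_cr (cross_ratio A B C D)" unfolding cross_ratio_def by (rule someI_ex)
  then show ?thesis by (rule unique)
qed

section \<open>The Menelaus condition\<close>

definition edge :: "(int^'m \<Rightarrow> real^'n) \<Rightarrow> int^'m \<Rightarrow> 'm \<Rightarrow> real^'n" where
  "edge f u i = f (sh u i) - f u"

text \<open>One function stores both coordinates of \<open>f (sh (sh u i) j)\<close>: swapping the
  last two arguments of \<open>p\<close> gives the coefficient of the other edge. The inequalities
  are the nondegeneracy of the face.\<close>

definition quad_coords :: "(int^'m \<Rightarrow> real^'n) \<Rightarrow> (int^'m \<Rightarrow> 'm \<Rightarrow> 'm \<Rightarrow> real) \<Rightarrow> bool" where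
  "quad_coords f p \<longleftrightarrow> (\<forall>u i j. i \<noteq> j \<longrightarrow>
     \<not> collinear {0, edge f u i, edge f u j} \<and>
     f (sh (sh u i) j) - f u = p u i j *\<^sub>R edge f u i + p u j i *\<^sub>R edge f u j \<and>
     p u i j \<noteq> 0 \<and> p u i j + p u j i \<noteq> 1 \<and> p u i j + p u j i \<noteq> 0)"

lemma quad_coordsD:
  assumes "quad_coords f p" "i \<noteq> j"
  shows "\<not> collinear {0, edge f u i, edge f u j}"
    "f (sh (sh u i) j) - f u = p u i j *\<^sub>R edge f u i + p u j i *\<^sub>R edge f u j"
    "p u i j \<noteq> 0" "p u i j + p u j i \<noteq> 1" "p u i j + p u j i \<noteq> 0"
  using assms unfolding quad_coords_def by blast+

lemma Q_net_quad_coords: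
  assumes "Q_net f"
  obtains p where "quad_coords f p"
proof -
  define ok where "ok u i j p r \<longleftrightarrow> \<not> collinear {0, edge f u i, edge f u j} \<and>
     f (sh (sh u i) j) - f u = p *\<^sub>R edge f u i + r *\<^sub>R edge f u j \<and>
     p \<noteq> 0 \<and> p + r \<noteq> 1 \<and> p + r \<noteq> 0" for u i j p r
  have "\<exists>p r. ok u i j p r" if "i \<noteq> j" for u i j
  proof -
    have "nondeg_quad (f u) (f (sh u i)) (f (sh (sh u i) j)) (f (sh u j))"
      using assms that unfolding Q_net_def by blast
    then show ?thesis by (rule nondeg_quad_imp_coords) (unfold edge_def ok_def, blast)
  qed
  moreover define p where "p u i j = (SOME p. \<exists>r. ok u i j p r)" for u i j
  moreover define r where "r u i j = (SOME r. ok u i j (p u i j) r)" for u i j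
  ultimately have "ok u i j (p u i j) (r u i j)" if "i \<noteq> j" for u i j
    using that by (metis (mono_tags) someI_ex)
  note pr = this[unfolded ok_def]
  \<comment> \<open>The faces taken in the orders \<open>i, j\<close> and \<open>j, i\<close> share
    their opposite vertex, so uniqueness of coordinates matches the independently chosen
    coefficients.\<close>
  have "r u i j = p u j i" if "i \<noteq> j" for u i j
  proof -
    have "p u i j *\<^sub>R edge f u i + r u i j *\<^sub>R edge f u j
        = r u j i *\<^sub>R edge f u i + p u j i *\<^sub>R edge f u j"
      using pr[OF that, of u] pr[OF that[symmetric], of u] sh_commute[of u i j]
      by (metis add.commute)
    then show ?thesis using not_collinear_coeffs_unique(2) pr[OF that] by blast
  qed
  then have "quad_coords f p" unfolding quad_coords_def using pr by (metis (no_types, lifting))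
  then show ?thesis using that by blast
qed

text \<open>The diagonal point of the face \<open>i, j\<close> divides the segment from
  \<open>f (sh u i)\<close> to \<open>f (sh u j)\<close> in the ratio
  \<open>p u j i : p u i j\<close>; Menelaus asks that the three such ratios around the triangle
  multiply to -1.\<close>

definition menelaus :: "(int^'m \<Rightarrow> 'm \<Rightarrow> 'm \<Rightarrow> real) \<Rightarrow> bool" where
  "menelaus p \<longleftrightarrow> (\<forall>u i j k. i \<noteq> j \<and> j \<noteq> k \<and> k \<noteq> i \<longrightarrow>
     p u i j * p u j k * p u k i = - (p u j i * p u k j * p u i k))"

lemma cross_ratio_product_iff_menelaus:
  fixes f :: "int^'m \<Rightarrow> real^'n"
  assumes qc: "quad_coords f p" and circ: "circular_net f"
    and ij: "i \<noteq> j" and jk: "j \<noteq> k" and ki: "k \<noteq> i"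
  shows "cross_ratio (f u) (f (sh u i)) (f (sh (sh u i) j)) (f (sh u j)) *
       cross_ratio (f u) (f (sh u j)) (f (sh (sh u j) k)) (f (sh u k)) *
       cross_ratio (f u) (f (sh u k)) (f (sh (sh u k) i)) (f (sh u i)) = 1 \<longleftrightarrow>
     p u i j * p u j k * p u k i = - (p u j i * p u k j * p u i k)"
proof -
  have cr: "cross_ratio (f u) (f (sh u i)) (f (sh (sh u i) j)) (f (sh u j))
      = of_real (- (p u i j / p u j i) * ((norm (edge f u i))\<^sup>2 / (norm (edge f u j))\<^sup>2))"
    if "i \<noteq> j" for i j
    unfolding edge_def
    by (rule cross_ratio_coords)
      (use quad_coordsD[OF qc that] quad_coordsD(3)[OF qc that[symmetric]] circ that
        in \<open>auto simp: edge_def circular_net_def\<close>)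
  define x y z where "x = (norm (edge f u i))\<^sup>2" and "y = (norm (edge f u j))\<^sup>2"
    and "z = (norm (edge f u k))\<^sup>2"
  have nz: "x \<noteq> 0" "y \<noteq> 0" "z \<noteq> 0"
    using quad_coordsD(1)[OF qc ij] quad_coordsD(1)[OF qc jk]
    by (auto simp: x_def y_def z_def collinear_lemma)
  note p = quad_coordsD(3)[OF qc]
  have "cross_ratio (f u) (f (sh u i)) (f (sh (sh u i) j)) (f (sh u j)) *
       cross_ratio (f u) (f (sh u j)) (f (sh (sh u j) k)) (f (sh u k)) *
       cross_ratio (f u) (f (sh u k)) (f (sh (sh u k) i)) (f (sh u i))
     = of_real ((- (p u i j / p u j i) * (x / y)) * (- (p u j k / p u k j) * (y / z))
         * (- (p u k i / p u i k) * (z / x)))"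
    unfolding cr[OF ij] cr[OF jk] cr[OF ki] x_def y_def z_def of_real_mult ..
  \<comment> \<open>The squared lengths cancel cyclically, and the three minus signs leave
    one.\<close>
  also have "(- (p u i j / p u j i) * (x / y)) * (- (p u j k / p u k j) * (y / z))
         * (- (p u k i / p u i k) * (z / x))
     = - (p u i j * p u j k * p u k i) / (p u j i * p u k j * p u i k)"
    using nz by (simp add: field_simps)
  finally have eq: "cross_ratio (f u) (f (sh u i)) (f (sh (sh u i) j)) (f (sh u j)) *
       cross_ratio (f u) (f (sh u j)) (f (sh (sh u j) k)) (f (sh u k)) *
       cross_ratio (f u) (f (sh u k)) (f (sh (sh u k) i)) (f (sh u i))
     = of_real (- (p u i j * p u j k * p u k i) / (p u j i * p u k j * p u i k))" .
  have "- N / M = 1 \<longleftrightarrow> N = - M" if "M \<noteq> 0" for M N :: real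
    using that by (auto simp: field_simps)
  moreover have "p u j i * p u k j * p u i k \<noteq> 0"
    using p[OF ij[symmetric]] p[OF jk[symmetric]] p[OF ki[symmetric]] by simp
  ultimately show ?thesis unfolding eq of_real_eq_1_iff by blast
qed

lemma koenigs_net_imp_menelaus:
  fixes f :: "int^'m \<Rightarrow> real^'n"
  assumes qc: "quad_coords f p" and "koenigs_net f"
  shows "menelaus p"
  unfolding menelaus_def
proof (intro allI impI)
  fix u :: "int^'m" and i j k :: 'm
  assume ne: "i \<noteq> j \<and> j \<noteq> k \<and> k \<noteq> i"
  obtain g :: "int^'m \<Rightarrow> real^'n" where g: "Q_net g"
    and dual: "\<And>u i j. i \<noteq> j \<Longrightarrow>
        dual_quad (f u) (f (sh u i)) (f (sh (sh u i) j)) (f (sh u j))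
                  (g u) (g (sh u i)) (g (sh (sh u i) j)) (g (sh u j))"
    using assms(2) unfolding koenigs_net_def by blast
  have "\<exists>a. edge g u i = a *\<^sub>R edge f u i" if "i \<noteq> j" for i j :: 'm
    using dual[OF that, of u] unfolding dual_quad_def par_def edge_def by blast
  then obtain ai aj ak where a: "edge g u i = ai *\<^sub>R edge f u i"
    "edge g u j = aj *\<^sub>R edge f u j" "edge g u k = ak *\<^sub>R edge f u k"
    using ne by metis
  \<comment> \<open>The dual diagonal \<open>edge g u j - edge g u i\<close> is a multiple
    \<open>c\<close> of \<open>f (sh (sh u i) j) - f u\<close>, so \<open>- x = c * p u i j\<close>
    and \<open>y = c * p u j i\<close>; eliminating \<open>c\<close> gives the relation.\<close>
  have ratio: "x * p u j i = - (y * p u i j) \<and> x \<noteq> 0"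
    if nij: "i \<noteq> j" and x: "edge g u i = x *\<^sub>R edge f u i" and y: "edge g u j = y *\<^sub>R edge f u j"
    for i j x y
  proof -
    obtain c where "g (sh u j) - g (sh u i) = c *\<^sub>R (f (sh (sh u i) j) - f u)"
      using dual[OF nij, of u] unfolding dual_quad_def par_def by blast
    then have "edge g u j - edge g u i = c *\<^sub>R (f (sh (sh u i) j) - f u)" by (simp add: edge_def)
    then have "(- x) *\<^sub>R edge f u i + y *\<^sub>R edge f u j
        = (c * p u i j) *\<^sub>R edge f u i + (c * p u j i) *\<^sub>R edge f u j"
      unfolding x y quad_coordsD(2)[OF qc nij] by (simp add: algebra_simps)
    note e = not_collinear_coeffs_unique[OF quad_coordsD(1)[OF qc nij] this]
    \<comment> \<open>\<open>par\<close> admits the factor 0, so the nonvanishing of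
      \<open>x\<close> is taken from the distinct vertices of \<open>g\<close>.\<close>
    have "g u \<noteq> g (sh u i)" using g nij unfolding Q_net_def nondeg_quad_def by auto
    then have "x \<noteq> 0" using x by (auto simp: edge_def)
    moreover have "x = - (c * p u i j)" using e(1) by simp
    ultimately show ?thesis using e(2) by simp
  qed
  have r: "ai * p u j i = - (aj * p u i j)" "aj * p u k j = - (ak * p u j k)"
    "ak * p u i k = - (ai * p u k i)" and nz: "ai \<noteq> 0" "aj \<noteq> 0" "ak \<noteq> 0"
    using ratio[of i j ai aj] ratio[of j k aj ak] ratio[of k i ak ai] ne a by auto
  have "(ai * aj * ak) * (p u j i * p u k j * p u i k)
      = (ai * p u j i) * (aj * p u k j) * (ak * p u i k)" by (simp only: mult_ac)
  also have "\<dots> = (ai * aj * ak) * - (p u i j * p u j k * p u k i)" unfolding r by simp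
  finally have "p u j i * p u k j * p u i k = - (p u i j * p u j k * p u k i)"
    using nz by (subst (asm) mult_left_cancel) auto
  then show "p u i j * p u j k * p u k i = - (p u j i * p u k j * p u i k)" by linarith
qed

section \<open>Compatibility on a cube and construction of the dual net\<close>

text \<open>The hypotheses \<open>x1\<close>--\<open>z2\<close> compare the coordinates of the eighth vertex of a cube, with
  respect to the three edges at the first vertex, computed from the three faces through it.\<close>
lemma dual_cube_scalars:
  fixes a1 a2 a3 :: real
  assumes a: "a1 \<noteq> 0" "a2 \<noteq> 0" "a3 \<noteq> 0" and p: "p21 \<noteq> 0" "p32 \<noteq> 0" "p13 \<noteq> 0"
    and r12: "a1 * p21 = - (a2 * p12)" and r23: "a2 * p32 = - (a3 * p23)"
    and r31: "a3 * p13 = - (a1 * p31)"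
    and x1: "1 + P1 * (p12 - 1) + R1 * (p13 - 1) = R2 * p12" and x2: "R2 * p12 = P3 * p13"
    and y1: "1 + P2 * (p23 - 1) + R2 * (p21 - 1) = P1 * p21" and y2: "P1 * p21 = R3 * p23"
    and z1: "1 + P3 * (p31 - 1) + R3 * (p32 - 1) = R1 * p31" and z2: "R1 * p31 = P2 * p32"
    and nd: "P1 + R1 \<noteq> 1"
  shows "P1 * (1 - p12 - p21) = - (R1 * (1 - p13 - p31))"
    and "a1 * (1 - P2 - R2) = a2 * (1 - P1 - R1)"
proof -
  \<comment> \<open>For edges \<open>F1, F2, F3\<close> of the cube, \<open>h3\<close> is the factor
    from the face diagonal \<open>p12 F1 + p21 F2\<close> to the dual diagonal
    \<open>a2 F2 - a1 F1\<close>; \<open>h1\<close> and \<open>h2\<close> belong likewise to the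
    faces 23 and 31.\<close>
  define h1 h2 h3 where "h1 = a3 / p32" and "h2 = a1 / p13" and "h3 = a2 / p21"
  have h: "h1 \<noteq> 0" "h2 \<noteq> 0" "h3 \<noteq> 0" using a p by (simp_all add: h1_def h2_def h3_def)
  have p21: "p21 = a2 / h3" and p32: "p32 = a3 / h1" and p13: "p13 = a1 / h2"
    using a p by (simp_all add: h1_def h2_def h3_def)
  have p12: "p12 = - a1 / h3" and p23: "p23 = - a2 / h1" and p31: "p31 = - a3 / h2"
    using r12 r23 r31 a p by (simp_all add: h1_def h2_def h3_def field_simps)
  \<comment> \<open>The equations \<open>x2\<close>, \<open>y2\<close>, \<open>z2\<close> pair the
    six coefficients \<open>P\<close>, \<open>R\<close>, so that three unknowns describe them
    all.\<close>
  define Y1 Y2 Y3 where "Y1 = P3 / h2" and "Y2 = P1 / h3" and "Y3 = P2 / h1"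
  have P: "P1 = Y2 * h3" "P2 = Y3 * h1" "P3 = Y1 * h2"
    using h by (simp_all add: Y1_def Y2_def Y3_def)
  have "a3 * R1 = a3 * - (Y3 * h2)" using z2 h by (simp add: p31 p32 P field_simps)
  then have R1: "R1 = - (Y3 * h2)" using a by (subst (asm) mult_left_cancel) auto
  have "a1 * R2 = a1 * - (Y1 * h3)" using x2 h by (simp add: p12 p13 P field_simps)
  then have R2: "R2 = - (Y1 * h3)" using a by (subst (asm) mult_left_cancel) auto
  have "a2 * R3 = a2 * - (Y2 * h1)" using y2 h by (simp add: p21 p23 P field_simps)
  then have R3: "R3 = - (Y2 * h1)" using a by (subst (asm) mult_left_cancel) auto
  \<comment> \<open>The other three equations now read \<open>a * S = 1 - P - R\<close> with one
    common \<open>S\<close>. This gives the second claim at once, and \<open>nd\<close> gives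
    \<open>S \<noteq> 0\<close>.\<close>
  define S where "S = Y1 + Y2 + Y3"
  have "P1 * p12 = - (a1 * Y2)" "R1 * p13 = - (a1 * Y3)" "R2 * p12 = a1 * Y1"
    using h by (simp_all add: P R1 R2 p12 p13)
  then have S1: "a1 * S = 1 - P1 - R1" using x1 by (simp add: S_def algebra_simps)
  have "P2 * p23 = - (a2 * Y3)" "R2 * p21 = - (a2 * Y1)" "P1 * p21 = a2 * Y2"
    using h by (simp_all add: P R2 p21 p23)
  then have S2: "a2 * S = 1 - P2 - R2" using y1 by (simp add: S_def algebra_simps)
  show "a1 * (1 - P2 - R2) = a2 * (1 - P1 - R1)"
    unfolding S1[symmetric] S2[symmetric] by simp
  have "P3 * p31 = - (a3 * Y1)" "R3 * p32 = - (a3 * Y2)" "R1 * p31 = a3 * Y3"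
    using h by (simp_all add: P R1 R3 p31 p32)
  then have S3: "a3 * S = 1 - P3 - R3" using z1 by (simp add: S_def algebra_simps)
  have S0: "S \<noteq> 0" using S1 nd by auto
  \<comment> \<open>Both factors needed for the first claim, multiplied by \<open>S\<close>, acquire
    the same cofactor \<open>h1 + h2 + h3\<close>; cross-multiplying by \<open>Y2\<close> and
    \<open>Y3\<close> and cancelling \<open>S\<close> finishes it.\<close>
  have "S * (h3 - a2 + a1) = S * h3 - a2 * S + a1 * S" by (simp add: algebra_simps)
  also have "\<dots> = Y3 * (h1 + h2 + h3)"
    unfolding S1 S2 by (simp add: P R1 R2 S_def algebra_simps)
  finally have e3: "S * (h3 - a2 + a1) = Y3 * (h1 + h2 + h3)" .
  have "S * (h2 - a1 + a3) = S * h2 - a1 * S + a3 * S" by (simp add: algebra_simps)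
  also have "\<dots> = Y2 * (h1 + h2 + h3)"
    unfolding S1 S3 by (simp add: P R1 R3 S_def algebra_simps)
  finally have e2: "S * (h2 - a1 + a3) = Y2 * (h1 + h2 + h3)" .
  have "S * (Y2 * (h3 - a2 + a1)) = Y2 * (S * (h3 - a2 + a1))" by (rule mult.left_commute)
  also have "\<dots> = Y3 * (S * (h2 - a1 + a3))" unfolding e3 e2 by (rule mult.left_commute)
  also have "\<dots> = S * (Y3 * (h2 - a1 + a3))" by (rule mult.left_commute)
  finally have "Y2 * (h3 - a2 + a1) = Y3 * (h2 - a1 + a3)" using S0 by simp
  moreover have "P1 * (1 - p12 - p21) = Y2 * (h3 - a2 + a1)"
    using h by (simp add: P p12 p21 field_simps)
  moreover have "R1 * (1 - p13 - p31) = - (Y3 * (h2 - a1 + a3))"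
    using h by (simp add: R1 p13 p31 field_simps)
  ultimately show "P1 * (1 - p12 - p21) = - (R1 * (1 - p13 - p31))" by simp
qed

text \<open>Menelaus is the multiplicative cocycle condition for the ratios
  \<open>- p u i j / p u j i\<close> at a fixed vertex, so they are quotients of a potential. It is
  normalised to 1 at an arbitrary index \<open>o0\<close>.\<close>

lemma menelaus_potential:
  fixes p :: "int^'m \<Rightarrow> 'm \<Rightarrow> 'm \<Rightarrow> real"
  assumes nz: "\<And>u i j. i \<noteq> j \<Longrightarrow> p u i j \<noteq> 0" and "menelaus p"
  obtains r where "\<And>u i. r u i \<noteq> 0"
    "\<And>u i j. i \<noteq> j \<Longrightarrow> r u i * p u j i = - (r u j * p u i j)"
proof -
  define o0 :: 'm where "o0 = undefined"
  define r where "r u i = (if i = o0 then 1 else - p u i o0 / p u o0 i)" for u i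
  have "r u i \<noteq> 0" for u i using nz by (simp add: r_def)
  moreover have "r u i * p u j i = - (r u j * p u i j)" if "i \<noteq> j" for u i j
  proof (cases "i = o0 \<or> j = o0")
    case True
    then show ?thesis using nz that by (auto simp: r_def)
  next
    case False
    then have "p u i j * p u j o0 * p u o0 i = - (p u j i * p u o0 j * p u i o0)"
      using \<open>menelaus p\<close> that unfolding menelaus_def by blast
    moreover have "p u o0 i \<noteq> 0" "p u o0 j \<noteq> 0" using False nz by metis+
    ultimately show ?thesis using False by (simp add: r_def field_simps)
  qed
  ultimately show ?thesis using that by blast
qed

text \<open>The eighth vertex of the cube is computed through the three faces at
  \<open>sh u i\<close>, \<open>sh u j\<close>, \<open>sh u k\<close>; general position makes the
  coefficients agree. The first conclusion later makes the transport factor independent of the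
  auxiliary direction, the second makes the transport flat.\<close>

lemma quad_coords_cube:
  fixes f :: "int^'m \<Rightarrow> real^'n"
  assumes qc: "quad_coords f p" and gp: "general_position f"
    and r0: "\<And>i. r i \<noteq> 0"
    and r: "\<And>i j. i \<noteq> j \<Longrightarrow> r i * p u j i = - (r j * p u i j)"
    and ij: "i \<noteq> j" and jk: "j \<noteq> k" and ki: "k \<noteq> i"
  shows "p (sh u i) j k * (1 - p u i j - p u j i) = - (p (sh u i) k j * (1 - p u i k - p u k i))"
    and "r i * (1 - p (sh u j) k i - p (sh u j) i k) = r j * (1 - p (sh u i) j k - p (sh u i) k j)"
proof -
  have face: "f (sh (sh (sh u i) j) k) - f u
      = (1 + p (sh u i) j k * (p u i j - 1) + p (sh u i) k j * (p u i k - 1)) *\<^sub>R edge f u i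
        + (p (sh u i) j k * p u j i) *\<^sub>R edge f u j + (p (sh u i) k j * p u k i) *\<^sub>R edge f u k"
    if ij: "i \<noteq> j" and jk: "j \<noteq> k" and ki: "k \<noteq> i" for i j k
  proof -
    have e: "edge f (sh u i) j = p u i j *\<^sub>R edge f u i + p u j i *\<^sub>R edge f u j - edge f u i"
      if "i \<noteq> j" for j
      using quad_coordsD(2)[OF qc that, of u] by (simp add: edge_def algebra_simps)
    have "f (sh (sh (sh u i) j) k) - f u
        = edge f u i + (f (sh (sh (sh u i) j) k) - f (sh u i))" by (simp add: edge_def)
    also have "\<dots> = edge f u i + (p (sh u i) j k *\<^sub>R edge f (sh u i) j
        + p (sh u i) k j *\<^sub>R edge f (sh u i) k)"
      unfolding quad_coordsD(2)[OF qc jk] ..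
    finally show ?thesis
      unfolding e[OF ij] e[OF ki[symmetric]] by (simp add: algebra_simps)
  qed
  have indep: "x = x' \<and> y = y' \<and> z = z'"
    if "x *\<^sub>R edge f u i + y *\<^sub>R edge f u j + z *\<^sub>R edge f u k
      = x' *\<^sub>R edge f u i + y' *\<^sub>R edge f u j + z' *\<^sub>R edge f u k" for x y z x' y' z'
  proof -
    have "\<not> coplanar {f u, f (sh u i), f (sh u j), f (sh u k)}"
      using gp ij jk ki unfolding general_position_def by blast
    moreover have "(x - x') *\<^sub>R edge f u i + (y - y') *\<^sub>R edge f u j + (z - z') *\<^sub>R edge f u k = 0"
      using that by (simp add: scaleR_left_diff_distrib algebra_simps)
    ultimately have "x - x' = 0 \<and> y - y' = 0 \<and> z - z' = 0"
      unfolding edge_def by (rule not_coplanar_independent)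
    then show ?thesis by simp
  qed
  have c2: "sh (sh (sh u j) k) i = sh (sh (sh u i) j) k"
    and c3: "sh (sh (sh u k) i) j = sh (sh (sh u i) j) k"
    by (metis sh_commute)+
  note f1 = face[OF ij jk ki]
  have f2: "f (sh (sh (sh u i) j) k) - f u = (p (sh u j) i k * p u i j) *\<^sub>R edge f u i
      + (1 + p (sh u j) k i * (p u j k - 1) + p (sh u j) i k * (p u j i - 1)) *\<^sub>R edge f u j
      + (p (sh u j) k i * p u k j) *\<^sub>R edge f u k"
    using face[OF jk ki ij] unfolding c2 by (simp only: add_ac)
  have f3: "f (sh (sh (sh u i) j) k) - f u = (p (sh u k) i j * p u i k) *\<^sub>R edge f u i
      + (p (sh u k) j i * p u j k) *\<^sub>R edge f u j
      + (1 + p (sh u k) i j * (p u k i - 1) + p (sh u k) j i * (p u k j - 1)) *\<^sub>R edge f u k"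
    using face[OF ki ij jk] unfolding c3 by (simp only: add_ac)
  note e12 = indep[OF trans[OF f1[symmetric] f2]] and e13 = indep[OF trans[OF f1[symmetric] f3]]
  note nz = quad_coordsD(3)[OF qc] and nd = quad_coordsD(4)[OF qc jk, of "sh u i"]
  have
    "1 + p (sh u i) j k * (p u i j - 1) + p (sh u i) k j * (p u i k - 1) = p (sh u j) i k * p u i j"
    "p (sh u j) i k * p u i j = p (sh u k) i j * p u i k"
    "1 + p (sh u j) k i * (p u j k - 1) + p (sh u j) i k * (p u j i - 1) = p (sh u i) j k * p u j i"
    "p (sh u i) j k * p u j i = p (sh u k) j i * p u j k"
    "1 + p (sh u k) i j * (p u k i - 1) + p (sh u k) j i * (p u k j - 1) = p (sh u i) k j * p u k i"
    "p (sh u i) k j * p u k i = p (sh u j) k i * p u k j"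
    using e12 e13 by simp_all
  note scalars = dual_cube_scalars[OF r0 r0 r0 nz[OF ij[symmetric]] nz[OF jk[symmetric]]
      nz[OF ki[symmetric]] r[OF ij] r[OF jk] r[OF ki] this nd]
  show "p (sh u i) j k * (1 - p u i j - p u j i) = - (p (sh u i) k j * (1 - p u i k - p u k i))"
    by (rule scalars(1))
  show "r i * (1 - p (sh u j) k i - p (sh u j) i k) = r j * (1 - p (sh u i) j k - p (sh u i) k j)"
    by (rule scalars(2))
qed

text \<open>The potential \<open>r\<close> fixes the edge factors at each vertex up to a common
  scalar \<sigma>. With \<open>a u i = \<sigma> u * r u i\<close>, the last requirement becomes a
  transport rule for \<sigma> alone.\<close>

lemma menelaus_imp_dual_scale:
  fixes f :: "int^'m \<Rightarrow> real^'n"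
  assumes card: "CARD('m) \<ge> 3" and qc: "quad_coords f p" and gp: "general_position f"
    and "menelaus p"
  obtains a where "\<And>u i. a u i \<noteq> 0"
    "\<And>u i j. i \<noteq> j \<Longrightarrow> a u i * p u j i = - (a u j * p u i j)"
    "\<And>u i j. i \<noteq> j \<Longrightarrow> a (sh u i) j * (1 - p u i j - p u j i) = a u i"
proof -
  note nz = quad_coordsD(3)[OF qc]
  obtain r where r0: "\<And>u i. r u i \<noteq> 0"
    and r: "\<And>u i j. i \<noteq> j \<Longrightarrow> r u i * p u j i = - (r u j * p u i j)"
    using menelaus_potential[OF nz \<open>menelaus p\<close>] by blast
  define L where "L u i j = 1 - p u i j - p u j i" for u i j
  have L0: "L u i j \<noteq> 0" if "i \<noteq> j" for u i j
    using quad_coordsD(4)[OF qc that, of u] by (simp add: L_def)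
  have L_sym: "L u i j = L u j i" for u i j by (simp add: L_def)
  note cube = quad_coords_cube[OF qc gp r0 r]
  have third: "\<exists>k. k \<noteq> i \<and> k \<noteq> j" for i j :: 'm
  proof (rule ccontr)
    assume "\<not> ?thesis"
    then have "(UNIV :: 'm set) \<subseteq> {i, j}" by blast
    then have "CARD('m) \<le> card {i, j}" by (simp add: card_mono)
    also have "\<dots> \<le> 2" by (simp add: card_insert_if)
    finally show False using card by simp
  qed
  have indep: "L u i j * r (sh u i) j = L u i k * r (sh u i) k" if "j \<noteq> i" "k \<noteq> i" for u i j k
  proof (cases "j = k")
    case False
    have A: "p (sh u i) j k * L u i j = - (p (sh u i) k j * L u i k)"
      unfolding L_def using cube(1)[of i j k u] that False by simp
    have "p (sh u i) k j * (L u i j * r (sh u i) j) = L u i j * (r (sh u i) j * p (sh u i) k j)"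
      by (simp only: mult_ac)
    also have "\<dots> = - r (sh u i) k * (p (sh u i) j k * L u i j)"
      unfolding r[OF False] by (simp add: mult_ac)
    also have "\<dots> = p (sh u i) k j * (L u i k * r (sh u i) k)" unfolding A by (simp add: mult_ac)
    finally show ?thesis using nz[of k j "sh u i"] False by simp
  qed simp
  \<comment> \<open>Solving the transport rule for the quotient of neighbouring values of \<sigma>
    gives this factor; \<open>indep\<close> shows that the choice of \<open>j\<close> does not
    matter.\<close>
  define c where "c u i = r u i / (L u i (SOME j. j \<noteq> i) * r (sh u i) (SOME j. j \<noteq> i))" for u i
  have c: "c u i = r u i / (L u i j * r (sh u i) j)" if "j \<noteq> i" for u i j
  proof -
    have "(SOME j. j \<noteq> i) \<noteq> i" using that by (rule someI)
    then show ?thesis unfolding c_def using indep[OF that] by metis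
  qed
  have c0: "c u i \<noteq> 0" for u i
  proof -
    obtain j where "j \<noteq> i" using third by blast
    then show ?thesis using c[of j i u] L0[of i j u] r0 by simp
  qed
  have "\<exists>\<sigma>. \<forall>u. \<sigma> u \<in> - {0} \<and> (\<forall>i. \<sigma> (sh u i) = c u i * \<sigma> u)"
  proof (rule flat_connection_section[where ?x0.0 = 1])
    show "bij_betw ((*) (c u i)) (- {0}) (- {0})" for u i
      by (rule bij_betw_byWitness[where f' = "\<lambda>x. x / c u i"]) (use c0 in auto)
    show "c (sh u i) j * (c u i * x) = c (sh u j) i * (c u j * x)" if ij: "i \<noteq> j" for u i j x
    proof -
      \<comment> \<open>Using a third direction \<open>k\<close> for the second step of both paths
        puts the same \<open>r w k\<close> in both denominators, and the intermediate values of
        \<open>r\<close> cancel. What remains is the cube identity \<open>B\<close>.\<close>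
      obtain k where k: "k \<noteq> i" "k \<noteq> j" using third by blast
      define w where "w = sh (sh u i) j"
      have w': "sh (sh u j) i = w" by (simp add: w_def sh_commute)
      have B: "r u i * L (sh u j) i k = r u j * L (sh u i) j k"
        unfolding L_def using cube(2)[of i j k u] k ij by (simp add: algebra_simps)
      have "c (sh u i) j * c u i = r u i / (L u i j * L (sh u i) j k * r w k)"
        using c[of j i u] c[of k j "sh u i"] ij k r0[of "sh u i" j] by (simp add: w_def)
      also have "\<dots> = r u j / (L u j i * L (sh u j) i k * r w k)"
        using B L0[of i j u] L0[of j k "sh u i"] L0[of i k "sh u j"] ij k r0[of w k] L_sym[of u i j]
        by (simp add: frac_eq_eq)
      also have "\<dots> = c (sh u j) i * c u j"
        using c[of i j u] c[of k i "sh u j"] ij k r0[of "sh u j" i] by (simp add: w')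
      finally show ?thesis by simp
    qed
  qed simp
  then obtain \<sigma> where \<sigma>0: "\<And>u. \<sigma> u \<noteq> 0" and \<sigma>: "\<And>u i. \<sigma> (sh u i) = c u i * \<sigma> u" by auto
  show ?thesis
  proof (rule that[of "\<lambda>u i. \<sigma> u * r u i"])
    show "\<sigma> u * r u i \<noteq> 0" for u i using \<sigma>0 r0 by simp
    show "\<sigma> u * r u i * p u j i = - (\<sigma> u * r u j * p u i j)" if "i \<noteq> j" for u i j
      using r[OF that, of u] by (simp add: mult.assoc)
    show "\<sigma> (sh u i) * r (sh u i) j * (1 - p u i j - p u j i) = \<sigma> u * r u i" if "i \<noteq> j" for u i j
      unfolding L_def[symmetric] \<sigma> c[OF that[symmetric]]
      using L0[OF that, of u] r0[of "sh u i" j] by simp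
  qed
qed

lemma menelaus_imp_koenigs_net:
  fixes f :: "int^'m \<Rightarrow> real^'n"
  assumes "CARD('m) \<ge> 3" and "Q_net f" and qc: "quad_coords f p" and "general_position f"
    and "menelaus p"
  shows "koenigs_net f"
proof -
  obtain a where a0: "\<And>u i. a u i \<noteq> 0"
    and a: "\<And>u i j. i \<noteq> j \<Longrightarrow> a u i * p u j i = - (a u j * p u i j)"
    and aL: "\<And>u i j. i \<noteq> j \<Longrightarrow> a (sh u i) j * (1 - p u i j - p u j i) = a u i"
    using menelaus_imp_dual_scale[OF assms(1) qc assms(4,5)] by blast
  define L where "L u i j = 1 - p u i j - p u j i" for u i j
  have L0: "L u i j \<noteq> 0" if "i \<noteq> j" for u i j
    using quad_coordsD(4)[OF qc that, of u] by (simp add: L_def)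
  have L_sym: "L u i j = L u j i" for u i j by (simp add: L_def)
  \<comment> \<open>Two successive dual edges add up to a multiple of the opposite diagonal of
    \<open>f\<close>. Exchanging \<open>i\<close> and \<open>j\<close> flips the sign of both
    factors, so the same formula shows that the edge field closes around a face.\<close>
  have diag: "a u i *\<^sub>R edge f u i + a (sh u i) j *\<^sub>R edge f (sh u i) j
      = (a u i * p u j i / L u i j) *\<^sub>R (edge f u j - edge f u i)" if ij: "i \<noteq> j" for u i j
  proof -
    have e: "edge f (sh u i) j = (p u i j - 1) *\<^sub>R edge f u i + p u j i *\<^sub>R edge f u j"
      using quad_coordsD(2)[OF qc ij, of u] by (simp add: edge_def algebra_simps)
    have aj: "a (sh u i) j = a u i / L u i j"
      using aL[OF ij, of u] L0[OF ij, of u] by (simp add: L_def eq_divide_eq)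
    have "a u i *\<^sub>R edge f u i + a (sh u i) j *\<^sub>R edge f (sh u i) j
        = (a u i + a u i / L u i j * (p u i j - 1)) *\<^sub>R edge f u i
          + (a u i / L u i j * p u j i) *\<^sub>R edge f u j"
      unfolding e aj by (simp only: scaleR_right_distrib scaleR_left_distrib scaleR_scaleR add_ac)
    also have "a u i + a u i / L u i j * (p u i j - 1) = - (a u i * p u j i / L u i j)"
      using L0[OF ij, of u] by (simp add: field_simps) (simp add: L_def algebra_simps)
    finally show ?thesis by (simp add: algebra_simps)
  qed
  have "\<exists>g. \<forall>u. g u \<in> UNIV \<and> (\<forall>i. g (sh u i) = g u + a u i *\<^sub>R edge f u i)"
  proof (rule flat_connection_section)
    show "bij_betw (\<lambda>x. x + a u i *\<^sub>R edge f u i) UNIV UNIV" for u i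
      by (rule bij_betw_byWitness[where f' = "\<lambda>x. x - a u i *\<^sub>R edge f u i"]) auto
    show "x + a u i *\<^sub>R edge f u i + a (sh u i) j *\<^sub>R edge f (sh u i) j
        = x + a u j *\<^sub>R edge f u j + a (sh u j) i *\<^sub>R edge f (sh u j) i" if "i \<noteq> j" for u i j x
      unfolding add.assoc diag[OF that] diag[OF that[symmetric]]
      using a[OF that, of u] L_sym[of u i j] by (simp add: algebra_simps)
  qed simp
  then obtain g where g: "\<And>u i. g (sh u i) = g u + a u i *\<^sub>R edge f u i" by blast
  have edge_g: "edge g u i = a u i *\<^sub>R edge f u i" for u i by (simp add: edge_def[of g] g)
  have diag_g: "g (sh (sh u i) j) - g u = (a u i * p u j i / L u i j) *\<^sub>R (edge f u j - edge f u i)"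
    if "i \<noteq> j" for u i j
    unfolding diag[OF that, symmetric] by (simp add: g)
  have "Q_net g"
    unfolding Q_net_def
  proof (intro allI impI)
    fix u i j assume ij: "(i :: 'm) \<noteq> j"
    note qD = quad_coordsD[OF qc ij, of u] and L0 = L0[OF ij, of u]
    have gi: "g (sh u i) - g u = a u i *\<^sub>R edge f u i" for i by (simp add: g)
    show "nondeg_quad (g u) (g (sh u i)) (g (sh (sh u i) j)) (g (sh u j))"
    \<comment> \<open>These coordinates result from dividing the factor in \<open>diag_g\<close> by
      \<open>a u i\<close> and \<open>a u j\<close>. With \<open>s = p u i j + p u j i\<close> their
      sum is \<open>- s / (1 - s)\<close>, which is never 1 and is nonzero because \<open>s\<close>
      is.\<close>
    proof (rule nondeg_quadI_coords[where p = "- p u j i / L u i j" and r = "- p u i j / L u i j"])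
      show "\<not> collinear {0, g (sh u i) - g u, g (sh u j) - g u}"
        unfolding gi using collinear_lincomb_iff[OF qD(1), of "a u i" 0 0 "a u j"] a0 by simp
      have "(- p u j i / L u i j) * a u i = - (a u i * p u j i / L u i j)"
        "(- p u i j / L u i j) * a u j = a u i * p u j i / L u i j"
        using a[OF ij, of u] by (simp_all add: mult.commute)
      then show "g (sh (sh u i) j) - g u = (- p u j i / L u i j) *\<^sub>R (g (sh u i) - g u)
          + (- p u i j / L u i j) *\<^sub>R (g (sh u j) - g u)"
        unfolding gi diag_g[OF ij] scaleR_scaleR by (simp add: scaleR_right_diff_distrib)
      show "- p u j i / L u i j \<noteq> 0" "- p u i j / L u i j \<noteq> 0"
        using qD(3) quad_coordsD(3)[OF qc ij[symmetric]] L0 by simp_all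
      show "- p u j i / L u i j + - p u i j / L u i j \<noteq> 1"
        "- p u j i / L u i j + - p u i j / L u i j \<noteq> 0"
        unfolding add_divide_distrib[symmetric] using qD(5) L0 by (auto simp: L_def)
    qed
  qed
  moreover have "dual_quad (f u) (f (sh u i)) (f (sh (sh u i) j)) (f (sh u j))
      (g u) (g (sh u i)) (g (sh (sh u i) j)) (g (sh u j))" if ij: "i \<noteq> j" for u i j
  proof -
    have "g (sh u i) - g u = a u i *\<^sub>R (f (sh u i) - f u)"
      "g (sh (sh u i) j) - g (sh u i) = a (sh u i) j *\<^sub>R (f (sh (sh u i) j) - f (sh u i))"
      using edge_g[of u i] edge_g[of "sh u i" j] by (simp_all add: edge_def)
    moreover have "g (sh u j) - g (sh (sh u i) j) = a (sh u j) i *\<^sub>R (f (sh u j) - f (sh (sh u i) j))"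
      "g u - g (sh u j) = a u j *\<^sub>R (f u - f (sh u j))"
      unfolding sh_commute[of u i j] by (simp_all add: g edge_def algebra_simps)
    moreover have "g (sh (sh u i) j) - g u
        = (a u i * p u j i / L u i j) *\<^sub>R (f (sh u j) - f (sh u i))"
      using diag_g[OF ij, of u] by (simp add: edge_def)
    \<comment> \<open>The factor is read off from the coefficient of \<open>edge f u j\<close>; the
      ratio relation for \<open>a\<close> makes the coefficient of \<open>edge f u i\<close>
      agree.\<close>
    moreover have "g (sh u j) - g (sh u i) = (a u j / p u j i) *\<^sub>R (f (sh (sh u i) j) - f u)"
    proof -
      have pji: "p u j i \<noteq> 0" using quad_coordsD(3)[OF qc ij[symmetric]] .
      then have "a u j / p u j i * p u i j = - a u i" using a[OF ij, of u] by (simp add: field_simps)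
      moreover have "g (sh u j) - g (sh u i) = (- a u i) *\<^sub>R edge f u i + a u j *\<^sub>R edge f u j"
        by (simp add: g)
      ultimately show ?thesis
        unfolding quad_coordsD(2)[OF qc ij] scaleR_right_distrib scaleR_scaleR using pji by simp
    qed
    ultimately show ?thesis unfolding dual_quad_def par_def by blast
  qed
  ultimately show ?thesis unfolding koenigs_net_def using \<open>Q_net f\<close> by blast
qed

theorem mainTheorem13:
  fixes f :: "int^'m \<Rightarrow> real^'n"
  assumes "CARD('m) \<ge> 3"
    and "circular_net f"
    and "general_position f"
  shows "isothermic_net f \<longleftrightarrow>
    (\<forall>u i j k. i \<noteq> j \<and> j \<noteq> k \<and> k \<noteq> i \<longrightarrow>
       cross_ratio (f u) (f (sh u i)) (f (sh (sh u i) j)) (f (sh u j)) *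
       cross_ratio (f u) (f (sh u j)) (f (sh (sh u j) k)) (f (sh u k)) *
       cross_ratio (f u) (f (sh u k)) (f (sh (sh u k) i)) (f (sh u i)) = 1)"
proof -
  have Q: "Q_net f" using assms(2) unfolding circular_net_def by blast
  then obtain p where qc: "quad_coords f p" by (rule Q_net_quad_coords)
  have "isothermic_net f \<longleftrightarrow> koenigs_net f" using assms(2) by (simp add: isothermic_net_def)
  also have "\<dots> \<longleftrightarrow> menelaus p"
    using koenigs_net_imp_menelaus[OF qc] menelaus_imp_koenigs_net[OF assms(1) Q qc assms(3)] by blast
  also have "\<dots> \<longleftrightarrow> (\<forall>u i j k. i \<noteq> j \<and> j \<noteq> k \<and> k \<noteq> i \<longrightarrow>
       cross_ratio (f u) (f (sh u i)) (f (sh (sh u i) j)) (f (sh u j)) *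
       cross_ratio (f u) (f (sh u j)) (f (sh (sh u j) k)) (f (sh u k)) *
       cross_ratio (f u) (f (sh u k)) (f (sh (sh u k) i)) (f (sh u i)) = 1)"
    unfolding menelaus_def using cross_ratio_product_iff_menelaus[OF qc assms(2)] by blast
  finally show ?thesis .
qed

end
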